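(* Let $M_1,M_2$ be distributive meet-semilattices and let $\alpha\colon M_1\to M_2$ be a map preserving all finite meets (including the top). The following are equivalent. (1) For every finite (possibly empty) $S\subseteq M_1$ and every upper bound $x$ of $\alpha[S]$ in $M_2$, there is an upper bound $c$ of $S$ in $M_1$ with $\alpha(c)\le x$. (2) If $P$ is a prime filter of $M_2$, then $\alpha^{-1}(P)$ is a prime filter of $M_1$. (3) If $I$ is an ideal of $M_2$, then $\alpha^{-1}(I)$ is an ideal of $M_1$.
   Context: A meet-semilattice is a poset in which all finite meets exist, including the empty one (so it has a top $1$, but possibly no bottom). It is distributive if $a\wedge b\le c$ implies there are $a'\ge a$, $b'\ge b$ with $a'\wedge b'=c$. A filter is a nonempty upset closed under binary meets. A filter $P\ne M$ of $M$ is prime if for all filters $F_1,F_2$ of $M$, $F_1\cap F_2\subseteq P$ implies $F_1\subseteq P$ or $F_2\subseteq P$. An ideal of $M$ is a nonempty downset $I$ such that $a,b\in I$ implies ${\uparrow}a\cap{\uparrow}b\cap I\ne\varnothing$. *)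

theory Defs
  imports "HOL-Library.Lub_Glb"
begin

class distributive_meet_semilattice = bounded_semilattice_inf_top +
  assumes meet_distributive:
    "inf a b \<le> c \<Longrightarrow> \<exists>a' b'. a \<le> a' \<and> b \<le> b' \<and> inf a' b' = c"

definition upset :: "'a::order set \<Rightarrow> bool" where
  "upset U \<longleftrightarrow> (\<forall>x\<in>U. \<forall>y. x \<le> y \<longrightarrow> y \<in> U)"

definition downset :: "'a::order set \<Rightarrow> bool" where
  "downset D \<longleftrightarrow> (\<forall>x\<in>D. \<forall>y. y \<le> x \<longrightarrow> y \<in> D)"

definition meet_filter :: "'a::semilattice_inf set \<Rightarrow> bool" where
  "meet_filter F \<longleftrightarrow> F \<noteq> {} \<and> upset F \<and> (\<forall>a\<in>F. \<forall>b\<in>F. inf a b \<in> F)"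

definition prime_meet_filter :: "'a::semilattice_inf set \<Rightarrow> bool" where
  "prime_meet_filter P \<longleftrightarrow>
     meet_filter P \<and> P \<noteq> UNIV \<and>
     (\<forall>F G. meet_filter F \<longrightarrow> meet_filter G \<longrightarrow> F \<inter> G \<subseteq> P \<longrightarrow> F \<subseteq> P \<or> G \<subseteq> P)"

definition meet_ideal :: "'a::semilattice_inf set \<Rightarrow> bool" where
  "meet_ideal I \<longleftrightarrow>
     I \<noteq> {} \<and> downset I \<and> (\<forall>a\<in>I. \<forall>b\<in>I. {a..} \<inter> {b..} \<inter> I \<noteq> {})"

(* The meet of a finite set S is its greatest lower bound; S may be empty, in which
   case its meet is the top element. *)
definition preserves_finite_meets ::
    "('a::bounded_semilattice_inf_top \<Rightarrow> 'b::bounded_semilattice_inf_top) \<Rightarrow> bool" where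
  "preserves_finite_meets f \<longleftrightarrow>
     (\<forall>S m. finite S \<longrightarrow> isGlb UNIV S m \<longrightarrow> isGlb UNIV (f ` S) (f m))"

lemma isGlb_UNIV_iff:
  "isGlb UNIV S (m::'a::order) \<longleftrightarrow> (\<forall>s\<in>S. m \<le> s) \<and> (\<forall>x. (\<forall>s\<in>S. x \<le> s) \<longrightarrow> x \<le> m)"
  by (auto simp: isGlb_def isLb_def greatestP_def setle_def setge_def)

lemma isGlb_UNIV_empty: "isGlb UNIV {} (m::'a::order_top) \<longleftrightarrow> m = top"
  by (metis isGlb_UNIV_iff empty_iff top_greatest top_le)

lemma isGlb_UNIV_insert:
  fixes n :: "'a::semilattice_inf"
  assumes "isGlb UNIV S n"
  shows "isGlb UNIV (insert s S) m \<longleftrightarrow> m = inf s n"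
proof -
  have *: "isGlb UNIV (insert s S) (inf s n)"
    using assms by (simp add: isGlb_UNIV_iff) (meson inf_le2 order_trans)
  show ?thesis
  proof
    assume "isGlb UNIV (insert s S) m"
    with * show "m = inf s n"
      unfolding isGlb_UNIV_iff by (meson order.antisym)
  qed (use * in simp)
qed

lemma preserves_finite_meets_iff:
  "preserves_finite_meets f \<longleftrightarrow> f top = top \<and> (\<forall>a b. f (inf a b) = inf (f a) (f b))"
proof
  assume f: "preserves_finite_meets f"
  have top: "f top = top"
    using f[unfolded preserves_finite_meets_def, rule_format, of "{}" top]
    by (simp add: isGlb_UNIV_empty)
  have "f (inf a b) = inf (f a) (f b)" for a b
    using f[unfolded preserves_finite_meets_def, rule_format, of "{a, b}" "inf a b"]
      isGlb_UNIV_insert[of "{b}" b a] isGlb_UNIV_insert[of "{f b}" "f b" "f a"]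
    by (simp add: isGlb_UNIV_iff[of "{b}"] isGlb_UNIV_iff[of "{f b}"])
  with top show "f top = top \<and> (\<forall>a b. f (inf a b) = inf (f a) (f b))" by simp
next
  assume f: "f top = top \<and> (\<forall>a b. f (inf a b) = inf (f a) (f b))"
  have "\<exists>m. isGlb UNIV S m \<and> isGlb UNIV (f ` S) (f m)" if "finite S" for S
    using that
  proof (induction S rule: finite_induct)
    case empty
    with f show ?case by (simp add: isGlb_UNIV_empty)
  next
    case (insert s S)
    then obtain n where "isGlb UNIV S n" "isGlb UNIV (f ` S) (f n)" by blast
    with f show ?case by (simp add: isGlb_UNIV_insert)
  qed
  moreover have "m = n" if "isGlb UNIV S m" "isGlb UNIV S n" for S and m n :: 'a
    using that unfolding isGlb_UNIV_iff by (meson order.antisym)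
  ultimately show "preserves_finite_meets f"
    unfolding preserves_finite_meets_def by metis
qed

end

theory Submission
  imports Defs
begin

text \<open>
  The link between the three conditions is that the prime filters are exactly the filters
  whose complement is an ideal (\<open>prime_meet_filter_iff_meet_ideal_Compl\<close>), and that ideals are
  exactly what the condition on upper bounds speaks about: an ideal is a nonempty directed
  downset, so every finite subset of it, the empty one included, has an upper bound inside it
  (\<open>meet_ideal_finite_upper_bound\<close>).

  Hence the condition on upper bounds and the condition on ideals are equivalent by elementary
  means: in one direction apply it to empty and two-element sets, in the other pull back the
  principal ideal below \<open>x\<close>. The condition on prime filters follows from the one on ideals by
  passing to complements: inverse images commute with complements, and \<open>\<alpha>\<close> pulls filters back
  to filters because it preserves finite meets.

  Distributivity enters on the way back from prime filters, through the prime filter theorem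
  (\<open>prime_meet_filter_separation\<close>). Suppose that \<open>x\<close> bounds \<open>\<alpha> ` S\<close> and that \<open>\<alpha> c \<le> x\<close> for no
  upper bound \<open>c\<close> of \<open>S\<close>. The images of the upper bounds of \<open>S\<close> then generate a filter
  that misses \<open>x\<close>, and some prime filter \<open>P\<close> above it still misses \<open>x\<close>. No \<open>\<alpha> s\<close> with
  \<open>s \<in> S\<close> lies in \<open>P\<close>, so \<open>S\<close> is a finite subset of the ideal complementary to \<open>\<alpha> -` P\<close> and
  has an upper bound there; but all upper bounds of \<open>S\<close> lie in \<open>\<alpha> -` P\<close>.
\<close>

section \<open>Filters\<close>

lemma meet_filterI:
  assumes "a \<in> F" "\<And>x y. x \<in> F \<Longrightarrow> x \<le> y \<Longrightarrow> y \<in> F"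
    and "\<And>x y. x \<in> F \<Longrightarrow> y \<in> F \<Longrightarrow> inf x y \<in> F"
  shows "meet_filter F"
  using assms unfolding meet_filter_def upset_def by blast

lemma meet_filter_upward: "meet_filter F \<Longrightarrow> x \<in> F \<Longrightarrow> x \<le> y \<Longrightarrow> y \<in> F"
  unfolding meet_filter_def upset_def by blast

lemma meet_filter_inf: "meet_filter F \<Longrightarrow> x \<in> F \<Longrightarrow> y \<in> F \<Longrightarrow> inf x y \<in> F"
  unfolding meet_filter_def by blast

lemma meet_filter_atLeast: "meet_filter {a..}"
  by (rule meet_filterI[of a]) auto

lemma meet_filter_vimage:
  fixes \<alpha> :: "'a::bounded_semilattice_inf_top \<Rightarrow> 'b::bounded_semilattice_inf_top"
  assumes top: "\<alpha> top = top" and inf: "\<And>a b. \<alpha> (inf a b) = inf (\<alpha> a) (\<alpha> b)"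
    and F: "meet_filter F"
  shows "meet_filter (\<alpha> -` F)"
proof (rule meet_filterI[of top])
  obtain a where "a \<in> F" using F unfolding meet_filter_def by blast
  then show "top \<in> \<alpha> -` F" using meet_filter_upward[OF F] top top_greatest by (metis vimage_eq)
  show "y \<in> \<alpha> -` F" if "x \<in> \<alpha> -` F" "x \<le> y" for x y
    using that meet_filter_upward[OF F] inf by (metis inf.absorb_iff1 inf.cobounded2 vimage_eq)
  show "inf x y \<in> \<alpha> -` F" if "x \<in> \<alpha> -` F" "y \<in> \<alpha> -` F" for x y
    using that meet_filter_inf[OF F] inf by simp
qed

section \<open>Ideals and complements of prime filters\<close>

text \<open>
  Testing primeness on the principal filters \<open>{a..}\<close> and \<open>{b..}\<close> of two points outside \<open>P\<close>
  produces a common upper bound outside \<open>P\<close>; conversely, such a bound lies in any two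
  filters containing \<open>a\<close> and \<open>b\<close> respectively. Properness of \<open>P\<close> corresponds to
  nonemptiness of the ideal.
\<close>

lemma prime_meet_filter_iff_meet_ideal_Compl:
  "prime_meet_filter P \<longleftrightarrow> meet_filter P \<and> meet_ideal (- P)"
proof safe
  assume P: "prime_meet_filter P"
  then show filter: "meet_filter P" unfolding prime_meet_filter_def by blast
  have "\<exists>c. a \<le> c \<and> b \<le> c \<and> c \<notin> P" if "a \<notin> P" "b \<notin> P" for a b
  proof -
    have "\<not> {a..} \<subseteq> P" "\<not> {b..} \<subseteq> P" using that by auto
    then have "\<not> {a..} \<inter> {b..} \<subseteq> P"
      using P meet_filter_atLeast unfolding prime_meet_filter_def by blast
    then show ?thesis by auto
  qed
  moreover have "P \<noteq> UNIV" using P unfolding prime_meet_filter_def by blast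
  moreover have "downset (- P)"
    using meet_filter_upward[OF filter] unfolding downset_def by blast
  ultimately show "meet_ideal (- P)" unfolding meet_ideal_def by fastforce
next
  assume filter: "meet_filter P" and ideal: "meet_ideal (- P)"
  have "F \<subseteq> P \<or> G \<subseteq> P" if FG: "meet_filter F" "meet_filter G" "F \<inter> G \<subseteq> P" for F G
  proof (rule ccontr)
    assume "\<not> (F \<subseteq> P \<or> G \<subseteq> P)"
    then obtain a b where ab: "a \<in> F" "a \<notin> P" "b \<in> G" "b \<notin> P" by blast
    then have "{a..} \<inter> {b..} \<inter> - P \<noteq> {}" using ideal unfolding meet_ideal_def by blast
    then obtain c where c: "a \<le> c" "b \<le> c" "c \<notin> P" by auto
    then have "c \<in> F \<inter> G" using FG ab meet_filter_upward by blast
    then show False using FG c by blast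
  qed
  then show "prime_meet_filter P"
    using filter ideal unfolding prime_meet_filter_def meet_ideal_def by blast
qed

lemma meet_ideal_atMost: "meet_ideal {..x}"
  unfolding meet_ideal_def downset_def by (auto intro: order_trans)

lemma meet_ideal_finite_upper_bound:
  assumes I: "meet_ideal I" and "finite S" "S \<subseteq> I"
  shows "\<exists>c\<in>I. \<forall>s\<in>S. s \<le> c"
  using assms(2,3)
proof (induction S rule: finite_induct)
  case empty
  then show ?case using I unfolding meet_ideal_def by blast
next
  case (insert s S)
  then obtain c where c: "c \<in> I" "\<forall>s\<in>S. s \<le> c" by blast
  moreover have "{s..} \<inter> {c..} \<inter> I \<noteq> {}"
    using I insert.prems c unfolding meet_ideal_def by blast
  ultimately show ?case by (auto intro: order_trans)
qed

section \<open>The prime filter theorem\<close>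

text \<open>The set below is the join of \<open>F\<close> and \<open>{a..}\<close> in the lattice of filters.\<close>

lemma meet_filter_adjoin:
  assumes F: "meet_filter F"
  shows "meet_filter {y. \<exists>p\<in>F. inf p a \<le> y}"
proof -
  obtain p where "p \<in> F" using F unfolding meet_filter_def by blast
  then have "a \<in> {y. \<exists>p\<in>F. inf p a \<le> y}" by auto
  moreover have "inf y z \<in> {y. \<exists>p\<in>F. inf p a \<le> y}"
    if yz: "p \<in> F" "inf p a \<le> y" "q \<in> F" "inf q a \<le> z" for p q y z
  proof -
    have "inf (inf p q) a \<le> inf p a" "inf (inf p q) a \<le> inf q a"
      by (simp_all add: le_infI1)
    then have "inf (inf p q) a \<le> inf y z" using yz by (meson le_inf_iff order_trans)
    then show ?thesis using meet_filter_inf[OF F] yz by blast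
  qed
  ultimately show ?thesis
    by (intro meet_filterI[of a]) (auto intro: order_trans)
qed

text \<open>
  This is distributivity of the lattice of filters in pointwise form: if \<open>x\<close> lies in the join
  of \<open>F\<close> with \<open>{a..}\<close> and in its join with \<open>{b..}\<close>, then it lies in the join of \<open>F\<close> with
  \<open>{a..} \<inter> {b..}\<close>. When the latter filter is contained in \<open>F\<close>, that join is \<open>F\<close> itself.
\<close>

lemma meet_filter_absorb:
  fixes a b x :: "'a::distributive_meet_semilattice"
  assumes F: "meet_filter F" and "p \<in> F" "q \<in> F"
    and pa: "inf p a \<le> x" and qb: "inf q b \<le> x" and ab: "{a..} \<inter> {b..} \<subseteq> F"
  shows "x \<in> F"
proof -
  obtain p' a' where a': "p \<le> p'" "a \<le> a'" "inf p' a' = x"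
    using meet_distributive[OF pa] by blast
  \<comment> \<open>Splitting \<open>a'\<close> rather than \<open>x\<close> makes the second factor lie above both \<open>a\<close> and \<open>b\<close>.\<close>
  have "inf q b \<le> a'" using qb a' by (metis inf.cobounded2 order_trans)
  then obtain q' b' where b': "q \<le> q'" "b \<le> b'" "inf q' b' = a'"
    using meet_distributive by blast
  have "a \<le> b'" using a' b' by (metis inf.cobounded2 order_trans)
  then have "b' \<in> F" using ab b' by auto
  moreover have "p' \<in> F" "q' \<in> F" using meet_filter_upward[OF F] assms(2,3) a' b' by blast+
  ultimately show ?thesis using meet_filter_inf[OF F] a' b' by metis
qed

text \<open>
  The prime filter theorem: a filter that is maximal among those avoiding \<open>x\<close> is prime.
  Adjoining a point outside it must capture \<open>x\<close>, so two points without a common upper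
  bound outside the filter would put \<open>x\<close> into it.
\<close>

lemma prime_meet_filter_separation:
  fixes x :: "'a::distributive_meet_semilattice"
  assumes F: "meet_filter F" and x: "x \<notin> F"
  shows "\<exists>P. prime_meet_filter P \<and> F \<subseteq> P \<and> x \<notin> P"
proof -
  define A where "A = {G. meet_filter G \<and> F \<subseteq> G \<and> x \<notin> G}"
  have "\<Union>C \<in> A" if C: "C \<noteq> {}" "subset.chain A C" for C
  proof -
    have filters: "\<And>G. G \<in> C \<Longrightarrow> meet_filter G \<and> F \<subseteq> G \<and> x \<notin> G"
      and chain: "\<And>G H. G \<in> C \<Longrightarrow> H \<in> C \<Longrightarrow> G \<subseteq> H \<or> H \<subseteq> G"
      using C(2) unfolding subset_chain_def A_def by blast+
    obtain G a where "G \<in> C" "a \<in> G"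
      using C(1) filters unfolding meet_filter_def by blast
    have "meet_filter (\<Union>C)"
    proof (rule meet_filterI[of a])
      show "a \<in> \<Union>C" using \<open>G \<in> C\<close> \<open>a \<in> G\<close> by blast
      show "z \<in> \<Union>C" if "y \<in> \<Union>C" "y \<le> z" for y z
        using that filters meet_filter_upward by blast
      show "inf y z \<in> \<Union>C" if yz: "y \<in> \<Union>C" "z \<in> \<Union>C" for y z
      proof -
        obtain G H where GH: "G \<in> C" "y \<in> G" "H \<in> C" "z \<in> H" using yz by blast
        then obtain K where "K \<in> C" "y \<in> K" "z \<in> K" using chain[of G H] by blast
        then show ?thesis using filters meet_filter_inf by blast
      qed
    qed
    then show ?thesis using C(1) filters unfolding A_def by blast
  qed
  moreover have "F \<in> A" using F x unfolding A_def by blast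
  ultimately obtain P where "P \<in> A" and maximal: "\<forall>X\<in>A. P \<subseteq> X \<longrightarrow> X = P"
    using subset_Zorn_nonempty[of A] by blast
  then have P: "meet_filter P" "F \<subseteq> P" "x \<notin> P" unfolding A_def by auto
  have capture: "\<exists>p\<in>P. inf p a \<le> x" if "a \<notin> P" for a
  proof (rule ccontr)
    assume none: "\<not> (\<exists>p\<in>P. inf p a \<le> x)"
    let ?Q = "{y. \<exists>p\<in>P. inf p a \<le> y}"
    have "P \<subseteq> ?Q" by (auto intro: le_infI1)
    moreover have "?Q \<in> A"
      using meet_filter_adjoin[OF P(1)] P(2) \<open>P \<subseteq> ?Q\<close> none unfolding A_def by auto
    ultimately have "?Q = P" using maximal by blast
    moreover have "a \<in> ?Q" using P(1) unfolding meet_filter_def by auto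
    ultimately show False using that by blast
  qed
  have "{a..} \<inter> {b..} \<inter> - P \<noteq> {}" if ab: "a \<notin> P" "b \<notin> P" for a b
  proof -
    obtain p where p: "p \<in> P" "inf p a \<le> x" using capture[OF ab(1)] by blast
    obtain q where q: "q \<in> P" "inf q b \<le> x" using capture[OF ab(2)] by blast
    have "\<not> {a..} \<inter> {b..} \<subseteq> P"
      using meet_filter_absorb[OF P(1) p(1) q(1) p(2) q(2)] P(3) by blast
    then show ?thesis by blast
  qed
  then have "meet_ideal (- P)"
    using P(3) meet_filter_upward[OF P(1)] unfolding meet_ideal_def downset_def by blast
  then have "prime_meet_filter P"
    using P(1) by (simp add: prime_meet_filter_iff_meet_ideal_Compl)
  then show ?thesis using P by blast
qed

section \<open>Inverse images of ideals and of prime filters\<close>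

text \<open>
  Here all finite sets reduce to two cases: the empty set gives nonemptiness of the inverse
  image, two-element sets give directedness.
\<close>

lemma meet_ideal_vimage_iff_upper_bounds:
  fixes \<alpha> :: "'a::semilattice_inf \<Rightarrow> 'b::semilattice_inf"
  assumes "mono \<alpha>"
  shows "(\<forall>I. meet_ideal I \<longrightarrow> meet_ideal (\<alpha> -` I)) \<longleftrightarrow>
    (\<forall>S x. finite S \<longrightarrow> (\<forall>s\<in>S. \<alpha> s \<le> x) \<longrightarrow> (\<exists>c. (\<forall>s\<in>S. s \<le> c) \<and> \<alpha> c \<le> x))"
    (is "?ideals \<longleftrightarrow> ?bounds")
proof
  assume ideals: ?ideals
  show ?bounds
  proof (intro allI impI)
    fix S x assume "finite S" "\<forall>s\<in>S. \<alpha> s \<le> x"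
    moreover have "meet_ideal (\<alpha> -` {..x})" using ideals meet_ideal_atMost by blast
    ultimately have "\<exists>c\<in>\<alpha> -` {..x}. \<forall>s\<in>S. s \<le> c"
      by (intro meet_ideal_finite_upper_bound) auto
    then show "\<exists>c. (\<forall>s\<in>S. s \<le> c) \<and> \<alpha> c \<le> x" by auto
  qed
next
  assume bounds: ?bounds
  show ?ideals
  proof (intro allI impI)
    fix I :: "'b set" assume I: "meet_ideal I"
    then have down: "\<And>x y. x \<in> I \<Longrightarrow> y \<le> x \<Longrightarrow> y \<in> I"
      unfolding meet_ideal_def downset_def by blast
    have bound: "\<exists>c\<in>\<alpha> -` I. \<forall>s\<in>S. s \<le> c" if S: "finite S" "S \<subseteq> \<alpha> -` I" for S
    proof -
      obtain x where "x \<in> I" "\<forall>s\<in>S. \<alpha> s \<le> x"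
        using meet_ideal_finite_upper_bound[OF I, of "\<alpha> ` S"] S by blast
      moreover from this obtain c where "\<forall>s\<in>S. s \<le> c" "\<alpha> c \<le> x"
        using bounds S(1) by blast
      ultimately show ?thesis using down by blast
    qed
    have "\<alpha> -` I \<noteq> {}" using bound[of "{}"] by auto
    moreover have "downset (\<alpha> -` I)"
      using monoD[OF assms] down unfolding downset_def by blast
    moreover have "{a..} \<inter> {b..} \<inter> \<alpha> -` I \<noteq> {}"
      if "a \<in> \<alpha> -` I" "b \<in> \<alpha> -` I" for a b
      using bound[of "{a, b}"] that by auto
    ultimately show "meet_ideal (\<alpha> -` I)" unfolding meet_ideal_def by blast
  qed
qed

lemma upper_bounds_if_prime_meet_filter_vimage:
  fixes \<alpha> :: "'a::bounded_semilattice_inf_top \<Rightarrow> 'b::distributive_meet_semilattice"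
  assumes inf: "\<And>a b. \<alpha> (inf a b) = inf (\<alpha> a) (\<alpha> b)"
    and prime: "\<And>P. prime_meet_filter P \<Longrightarrow> prime_meet_filter (\<alpha> -` P)"
    and S: "finite S" and x: "\<forall>s\<in>S. \<alpha> s \<le> x"
  shows "\<exists>c. (\<forall>s\<in>S. s \<le> c) \<and> \<alpha> c \<le> x"
proof (rule ccontr)
  assume none: "\<not> ?thesis"
  define F where "F = {y. \<exists>c. (\<forall>s\<in>S. s \<le> c) \<and> \<alpha> c \<le> y}"
  have "meet_filter F"
  proof (rule meet_filterI[of "\<alpha> top"])
    show "\<alpha> top \<in> F" unfolding F_def using top_greatest by blast
    show "z \<in> F" if "y \<in> F" "y \<le> z" for y z
      using that unfolding F_def by (auto intro: order_trans)
    show "inf y z \<in> F" if yz: "y \<in> F" "z \<in> F" for y z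
    proof -
      obtain c d where "\<forall>s\<in>S. s \<le> c" "\<alpha> c \<le> y" "\<forall>s\<in>S. s \<le> d" "\<alpha> d \<le> z"
        using yz unfolding F_def by blast
      then have "(\<forall>s\<in>S. s \<le> inf c d) \<and> \<alpha> (inf c d) \<le> inf y z"
        using inf_mono[of "\<alpha> c" y "\<alpha> d" z] by (simp add: inf del: le_inf_iff)
      then show ?thesis unfolding F_def by blast
    qed
  qed
  moreover have "x \<notin> F" using none unfolding F_def by blast
  ultimately obtain P where P: "prime_meet_filter P" "F \<subseteq> P" "x \<notin> P"
    using prime_meet_filter_separation by blast
  then have "meet_filter P" unfolding prime_meet_filter_def by blast
  then have "\<alpha> s \<notin> P" if "s \<in> S" for s
    using meet_filter_upward[of P "\<alpha> s" x] x P(3) that by blast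
  then have "S \<subseteq> - (\<alpha> -` P)" by blast
  moreover have "meet_ideal (- (\<alpha> -` P))"
    using prime[OF P(1)] by (simp add: prime_meet_filter_iff_meet_ideal_Compl)
  ultimately obtain c where "c \<notin> \<alpha> -` P" "\<forall>s\<in>S. s \<le> c"
    using meet_ideal_finite_upper_bound[of "- (\<alpha> -` P)" S] S by blast
  then show False using P(2) unfolding F_def by blast
qed

theorem lemma5p32:
  fixes \<alpha> :: "'a::distributive_meet_semilattice \<Rightarrow> 'b::distributive_meet_semilattice"
  assumes "preserves_finite_meets \<alpha>"
  shows "((\<forall>S x. finite S \<longrightarrow> (\<forall>s\<in>S. \<alpha> s \<le> x) \<longrightarrow>
              (\<exists>c. (\<forall>s\<in>S. s \<le> c) \<and> \<alpha> c \<le> x))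
          \<longleftrightarrow> (\<forall>P. prime_meet_filter P \<longrightarrow> prime_meet_filter (\<alpha> -` P)))
       \<and> ((\<forall>P. prime_meet_filter P \<longrightarrow> prime_meet_filter (\<alpha> -` P))
          \<longleftrightarrow> (\<forall>I. meet_ideal I \<longrightarrow> meet_ideal (\<alpha> -` I)))"
proof -
  have top: "\<alpha> top = top" and inf: "\<And>a b. \<alpha> (inf a b) = inf (\<alpha> a) (\<alpha> b)"
    using assms by (auto simp: preserves_finite_meets_iff)
  have "mono \<alpha>" using inf by (metis inf.absorb_iff1 inf.cobounded2 monoI)
  note ideals_iff_bounds = meet_ideal_vimage_iff_upper_bounds[OF this]
  have primes: "\<forall>P. prime_meet_filter P \<longrightarrow> prime_meet_filter (\<alpha> -` P)"
    if "\<forall>I. meet_ideal I \<longrightarrow> meet_ideal (\<alpha> -` I)"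
    using that meet_filter_vimage[of \<alpha>, OF top inf]
    by (simp add: prime_meet_filter_iff_meet_ideal_Compl flip: vimage_Compl)
  have bounds: "\<forall>S x. finite S \<longrightarrow> (\<forall>s\<in>S. \<alpha> s \<le> x) \<longrightarrow>
      (\<exists>c. (\<forall>s\<in>S. s \<le> c) \<and> \<alpha> c \<le> x)"
    if "\<forall>P. prime_meet_filter P \<longrightarrow> prime_meet_filter (\<alpha> -` P)"
    using that upper_bounds_if_prime_meet_filter_vimage[of \<alpha>, OF inf] by simp
  show ?thesis using ideals_iff_bounds primes bounds by argo
qed

end
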